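(* Let $G_1(n)$ be as defined in the context (steal limit $\sigma=1$). Then: (i) $G_1(n)=y_n(1)$ for all $n\ge0$, where $y_n(z)=\sum_{i=0}^n\frac{(n+i)!\,z^i}{(n-i)!\,i!\,2^i}$ is the Bessel polynomial. (ii) $G_1(n)={}_2F_0\!\left[n+1,-n;\,-;\,-\tfrac12\right]$ for all $n\ge0$, where ${}_2F_0[a,b;-;z]=\sum_{j\ge0}(a)_j(b)_j\frac{z^j}{j!}$ (a finite sum here since $-n$ is a nonpositive integer), and $(a)_j=a(a+1)\cdots(a+j-1)$. (iii) $G_1(n)=(2n-1)G_1(n-1)+G_1(n-2)$ for all $n\ge2$, with $G_1(0)=1$, $G_1(1)=2$. (iv) $\displaystyle\sum_{n=0}^\infty G_1(n)\frac{x^n}{n!}=\frac{e^{1-\sqrt{1-2x}}}{\sqrt{1-2x}}$. (v) $G_1(n)\sim \dfrac{e\,(2n)!}{n!\,2^n}$ as $n\to\infty$.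
   Context: Gift exchange game with steal limit $\sigma\ge 0$ and $m\ge 1$ gifts: there are $m$ players and $m$ distinct wrapped gifts, initially all in a pool. The players are called one at a time in a fixed order. When a player is called, and also whenever a player's gift has just been stolen, that player (who currently holds no gift) makes a move: either take one of the gifts still in the pool (it is unwrapped and held by that player), or steal an unwrapped gift currently held by another player, provided this gift has so far been stolen fewer than $\sigma$ times in total; the player from whom it was stolen then immediately makes a move. The game ends as soon as the last gift in the pool is taken. A scenario is the complete sequence of moves (which player took which gift at each move). For $n\ge 0$, $G_\sigma(n)$ is the number of scenarios of the game with $m=n+1$ gifts in which the gifts are taken from the pool in the order $1,2,\ldots,n+1$. *)

theory Defs
  imports "HOL-Analysis.Analysis" "HOL-Library.Landau_Symbols"
begin

text \<open>
  Players and gifts are both numbered \<open>1, \<dots>, m\<close>; players are called in the order \<open>1, \<dots>, m\<close>.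
  \<open>mover\<close> is the player whose move it is, \<open>called\<close> the number of players called so far,
  \<open>holder s g = None\<close> means that gift \<open>g\<close> is still wrapped in the pool, and \<open>steals s g\<close> is
  the number of times \<open>g\<close> has been stolen so far.
\<close>

record game_state =
  mover :: nat
  called :: nat
  holder :: "nat \<Rightarrow> nat option"
  steals :: "nat \<Rightarrow> nat"

definition pool :: "nat \<Rightarrow> game_state \<Rightarrow> nat set" where
  "pool m s = {g \<in> {1..m}. holder s g = None}"

definition initial_state :: game_state where
  "initial_state = \<lparr>mover = 1, called = 1, holder = (\<lambda>_. None), steals = (\<lambda>_. 0)\<rparr>"

text \<open>
  After a move to the pool nobody is without a gift among the players called so far, so the next
  player is called. After the last gift is unwrapped this names a nonexistent player \<open>m + 1\<close>,
  who never moves because the game is over.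
\<close>

definition after_unwrap :: "nat \<Rightarrow> game_state \<Rightarrow> game_state" where
  "after_unwrap g s =
     s\<lparr>mover := Suc (called s), called := Suc (called s),
       holder := (holder s)(g := Some (mover s))\<rparr>"

definition after_steal :: "nat \<Rightarrow> nat \<Rightarrow> game_state \<Rightarrow> game_state" where
  "after_steal q g s =
     s\<lparr>mover := q, holder := (holder s)(g := Some (mover s)),
       steals := (steals s)(g := Suc (steals s g))\<rparr>"

text \<open>
  \<open>plays \<sigma> m s ms gs\<close>: from state \<open>s\<close>, the list \<open>ms\<close> of moves (player, gift taken) is a legal
  continuation up to the end of the game, and \<open>gs\<close> lists the gifts taken from the pool during
  \<open>ms\<close>, in order.
\<close>

inductive plays ::
  "nat \<Rightarrow> nat \<Rightarrow> game_state \<Rightarrow> (nat \<times> nat) list \<Rightarrow> nat list \<Rightarrow> bool"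
  for \<sigma> m :: nat
where
  game_over: "pool m s = {} \<Longrightarrow> plays \<sigma> m s [] []"
| unwrap: "\<lbrakk>g \<in> pool m s; plays \<sigma> m (after_unwrap g s) ms gs\<rbrakk>
    \<Longrightarrow> plays \<sigma> m s ((mover s, g) # ms) (g # gs)"
| steal: "\<lbrakk>pool m s \<noteq> {}; g \<in> {1..m}; holder s g = Some q; q \<noteq> mover s; steals s g < \<sigma>;
      plays \<sigma> m (after_steal q g s) ms gs\<rbrakk>
    \<Longrightarrow> plays \<sigma> m s ((mover s, g) # ms) gs"

definition G :: "nat \<Rightarrow> nat \<Rightarrow> nat" where
  "G \<sigma> n = card {ms. plays \<sigma> (n + 1) initial_state ms [1..<n + 2]}"

definition bessel_y :: "nat \<Rightarrow> real \<Rightarrow> real" where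
  "bessel_y n z = (\<Sum>i=0..n. fact (n + i) * z ^ i / (fact (n - i) * fact i * 2 ^ i))"

definition hyp2F0 :: "real \<Rightarrow> real \<Rightarrow> real \<Rightarrow> real" where
  "hyp2F0 a b z = (\<Sum>j. pochhammer a j * pochhammer b j * (z ^ j / fact j))"

end

theory Submission
  imports Defs "HOL-Complex_Analysis.Cauchy_Integral_Formula" "HOL-Real_Asymp.Real_Asymp"
begin

text \<open>
  With \<open>r\<close> gifts in the pool and \<open>a\<close> unwrapped gifts that may still be stolen, the next move
  either unwraps a gift, \<open>(r, a) \<rightarrow> (r - 1, a + 1)\<close>, or steals one of the \<open>a\<close> gifts,
  \<open>(r, a) \<rightarrow> (r, a - 1)\<close>. The exponential generating functions \<open>f\<^sub>r\<close> in \<open>a\<close> of the resulting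
  counts therefore satisfy \<open>f\<^sub>0 = e\<^sup>x\<close> and \<open>(1 - x) f\<^sub>r\<^sub>+\<^sub>1 = f\<^sub>r'\<close>, whence \<open>f\<^sub>n\<^sub>+\<^sub>1\<close> is \<open>e\<^sup>x\<close> times
  a Bessel polynomial in \<open>1 / (1 - x)\<close>, up to a monomial factor, and \<open>G\<^sub>1(n) = f\<^sub>n\<^sub>+\<^sub>1(0)\<close>.
  Substituting \<open>x = 1 - sqrt (1 - 2u)\<close> turns \<open>(1 - x)\<^sup>-\<^sup>1 d/dx\<close> into \<open>d/du\<close>, so that the same
  computation gives the Taylor coefficients of \<open>e\<^sup>1\<^sup>-\<^sup>s / s\<close>, where \<open>s = sqrt (1 - 2u)\<close>. For the
  asymptotics, reverse the sum and divide by its top coefficient: the \<open>k\<close>-th term tends to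
  \<open>1 / k!\<close> and is bounded by it.
\<close>

section \<open>Counting scenarios\<close>

text \<open>Unwrapping counts once because the order of the pool gifts is prescribed. A stolen gift
  is out of reach from then on, so a theft lowers \<open>a\<close>.\<close>

fun continuations :: "nat \<Rightarrow> nat \<Rightarrow> nat" where
  "continuations 0 a = 1"
| "continuations (Suc r) 0 = continuations r 1"
| "continuations (Suc r) (Suc a) =
     continuations r (Suc (Suc a)) + Suc a * continuations (Suc r) a"

text \<open>At \<open>a = 0\<close> the factor \<open>a\<close> kills the truncated term, which
  merges the two recursive clauses.\<close>

lemma continuations_Suc:
  "continuations (Suc r) a = continuations r (Suc a) + a * continuations (Suc r) (a - 1)"
  by (cases a) auto

text \<open>
  Invariant of the game while exactly the gifts \<open>1, \<dots>, k\<close> are unwrapped. Injectivity of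
  \<open>holder\<close> ensures that the victim of a theft is left without a gift.
\<close>
definition ordered_state :: "nat \<Rightarrow> nat \<Rightarrow> game_state \<Rightarrow> bool" where
  "ordered_state m k s \<longleftrightarrow>
     k \<le> m \<and> called s = Suc k \<and> mover s \<le> Suc k \<and>
     (\<forall>g. holder s g = None \<longleftrightarrow> g \<notin> {1..k}) \<and>
     (\<forall>g q. holder s g = Some q \<longrightarrow> q \<le> Suc k \<and> q \<noteq> mover s) \<and>
     (\<forall>g h q. holder s g = Some q \<longrightarrow> holder s h = Some q \<longrightarrow> g = h) \<and>
     (\<forall>g. g \<notin> {1..k} \<longrightarrow> steals s g = 0)"

text \<open>With steal limit 1 and a nonempty pool these are exactly the gifts open to theft: in an
  \<open>ordered_state\<close> the mover holds nothing, so each belongs to another player.\<close>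

definition stealable :: "nat \<Rightarrow> game_state \<Rightarrow> nat set" where
  "stealable k s = {g \<in> {1..k}. steals s g = 0}"

lemma ordered_state_initial: "ordered_state m 0 initial_state"
  by (simp add: ordered_state_def initial_state_def)

lemma ordered_state_holder:
  assumes "ordered_state m k s"
  shows "holder s g = None \<longleftrightarrow> g \<notin> {1..k}"
  using assms by (simp add: ordered_state_def)

lemma ordered_state_pool:
  assumes "ordered_state m k s"
  shows "pool m s = {Suc k..m}"
  using assms by (auto simp: ordered_state_def pool_def)

lemma ordered_state_unwrap:
  assumes "ordered_state m k s" "k < m"
  shows "ordered_state m (Suc k) (after_unwrap (Suc k) s)"
    and "stealable (Suc k) (after_unwrap (Suc k) s) = insert (Suc k) (stealable k s)"
proof -
  show "ordered_state m (Suc k) (after_unwrap (Suc k) s)"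
    unfolding ordered_state_def
  proof (intro conjI allI impI)
    fix g h q
    assume "holder (after_unwrap (Suc k) s) g = Some q" "holder (after_unwrap (Suc k) s) h = Some q"
    then show "g = h"
      using assms unfolding ordered_state_def after_unwrap_def
      by (simp split: if_splits) metis+
  next
    fix g q
    assume "holder (after_unwrap (Suc k) s) g = Some q"
    \<comment> \<open>One better than the invariant demands: the new mover is
      \<open>Suc (Suc k)\<close>, so this bound separates it from all holders.\<close>
    then have "q \<le> Suc k"
      using assms unfolding ordered_state_def after_unwrap_def
      by (auto split: if_splits)
    then show "q \<le> Suc (Suc k)" "q \<noteq> mover (after_unwrap (Suc k) s)"
      using assms by (auto simp: ordered_state_def after_unwrap_def)
  qed (use assms in \<open>auto simp: ordered_state_def after_unwrap_def\<close>)
  show "stealable (Suc k) (after_unwrap (Suc k) s) = insert (Suc k) (stealable k s)"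
    using assms unfolding stealable_def ordered_state_def after_unwrap_def
    by (auto simp: le_Suc_eq)
qed

text \<open>The thief held nothing and the victim only \<open>g\<close>, so they merely exchange
  roles; \<open>g\<close> has now reached the steal limit.\<close>

lemma ordered_state_steal:
  assumes "ordered_state m k s" "g \<in> stealable k s" "holder s g = Some q"
  shows "ordered_state m k (after_steal q g s)"
    and "stealable k (after_steal q g s) = stealable k s - {g}"
proof -
  show "ordered_state m k (after_steal q g s)"
    using assms unfolding ordered_state_def after_steal_def stealable_def
    by simp metis
  show "stealable k (after_steal q g s) = stealable k s - {g}"
    unfolding stealable_def after_steal_def by auto
qed

section \<open>Recursion on the first move\<close>

definition ordered_plays :: "nat \<Rightarrow> nat \<Rightarrow> game_state \<Rightarrow> (nat \<times> nat) list set" where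
  "ordered_plays m k s = {ms. plays 1 m s ms [Suc k..<Suc m]}"

lemma ordered_plays_over:
  assumes "ordered_state m m s"
  shows "ordered_plays m m s = {[]}"
  using ordered_state_pool[OF assms]
  by (auto simp: ordered_plays_def intro: plays.game_over elim: plays.cases)

text \<open>The prescribed list forces an unwrapped gift to be \<open>Suc k\<close>; a theft leaves
  that list as it is.\<close>

lemma ordered_plays_step:
  assumes s: "ordered_state m k s" and "k < m"
  shows "ordered_plays m k s =
    (#) (mover s, Suc k) ` ordered_plays m (Suc k) (after_unwrap (Suc k) s) \<union>
    (\<Union>g\<in>stealable k s. (#) (mover s, g) ` ordered_plays m k (after_steal (the (holder s g)) g s))"
    (is "_ = ?U \<union> ?S")
proof
  have pool: "pool m s = {Suc k..m}"
    using ordered_state_pool[OF s] .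
  have upt: "[Suc k..<Suc m] = Suc k # [Suc (Suc k)..<Suc m]"
    using \<open>k < m\<close> upt_conv_Cons by auto
  show "ordered_plays m k s \<subseteq> ?U \<union> ?S"
  proof
    fix ms assume "ms \<in> ordered_plays m k s"
    then have "plays 1 m s ms [Suc k..<Suc m]"
      by (simp add: ordered_plays_def)
    then show "ms \<in> ?U \<union> ?S"
    proof cases
      case game_over
      then show ?thesis using pool \<open>k < m\<close> by simp
    next
      case (unwrap g ms' gs)
      then show ?thesis
        by (auto simp: upt ordered_plays_def simp del: upt_Suc)
    next
      case (steal g q ms')
      have "g \<in> stealable k s"
        using ordered_state_holder[OF s, of g] steal(4,6) by (simp add: stealable_def)
      moreover have "ms' \<in> ordered_plays m k (after_steal (the (holder s g)) g s)"
        using steal(4,7) by (simp add: ordered_plays_def)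
      ultimately show ?thesis
        unfolding steal(1) by blast
    qed
  qed
  have "(mover s, Suc k) # ms \<in> ordered_plays m k s"
    if "ms \<in> ordered_plays m (Suc k) (after_unwrap (Suc k) s)" for ms
    using that plays.unwrap[of "Suc k" m s 1 ms] pool \<open>k < m\<close>
    unfolding ordered_plays_def upt by simp
  moreover have "(mover s, g) # ms \<in> ordered_plays m k s"
    if g: "g \<in> stealable k s" and ms: "ms \<in> ordered_plays m k (after_steal (the (holder s g)) g s)"
    for g ms
  proof -
    obtain q where q: "holder s g = Some q"
      using g ordered_state_holder[OF s, of g] by (auto simp: stealable_def)
    have "q \<noteq> mover s" "g \<in> {1..m}" "steals s g < 1"
      using g s q by (auto simp: stealable_def ordered_state_def)
    then show ?thesis
      using plays.steal[of m s g q 1] ms q pool \<open>k < m\<close> by (auto simp: ordered_plays_def)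
  qed
  ultimately show "?U \<union> ?S \<subseteq> ordered_plays m k s"
    by auto
qed

text \<open>Lexicographic induction: unwrapping lowers \<open>m - k\<close> but raises the number of
  stealable gifts, a theft lowers only the latter. Finiteness is carried along for the cardinalities
  of the unions.\<close>

lemma card_ordered_plays:
  assumes "ordered_state m k s"
  shows "finite (ordered_plays m k s) \<and>
    card (ordered_plays m k s) = continuations (m - k) (card (stealable k s))"
proof -
  have "finite (ordered_plays m k s) \<and> card (ordered_plays m k s) = continuations r a"
    if "ordered_state m k s" "m - k = r" "card (stealable k s) = a" for r a
    using that
  proof (induction "(r, a)" arbitrary: r a k s rule: wf_induct_rule[OF wf_lex_prod[OF wf_less_than wf_less_than]])
    case 1
    note s = 1(2)
    have fin: "finite (stealable k s)"
      by (simp add: stealable_def)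
    show ?case
    proof (cases r)
      case 0
      then have "k = m"
        using 1(2,3) by (simp add: ordered_state_def)
      then show ?thesis
        using ordered_plays_over s 0 by simp
    next
      case (Suc r')
      then have "k < m" using 1(3) by simp
      let ?U = "ordered_plays m (Suc k) (after_unwrap (Suc k) s)"
      let ?S = "\<lambda>g. ordered_plays m k (after_steal (the (holder s g)) g s)"
      have "card (stealable (Suc k) (after_unwrap (Suc k) s)) = Suc a"
        using ordered_state_unwrap(2)[OF s \<open>k < m\<close>] fin 1(4) by (simp add: stealable_def)
      moreover have "m - Suc k = r'"
        using 1(3) Suc by simp
      ultimately have U: "finite ?U" "card ?U = continuations r' (Suc a)"
        using 1(1)[OF _ ordered_state_unwrap(1)[OF s \<open>k < m\<close>], of r' "Suc a"] Suc by auto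
      have S: "finite (?S g) \<and> card (?S g) = continuations r (a - 1)" if g: "g \<in> stealable k s" for g
      proof -
        obtain q where q: "holder s g = Some q"
          using g ordered_state_holder[OF s, of g] by (auto simp: stealable_def)
        have "a \<noteq> 0"
          using g fin 1(4) by (metis card_0_eq empty_iff)
        moreover have "card (stealable k (after_steal q g s)) = a - 1"
          using ordered_state_steal(2)[OF s g q] g fin 1(4) by simp
        ultimately show ?thesis
          using 1(1)[OF _ ordered_state_steal(1)[OF s g q], of r "a - 1"] 1(3) q by auto
      qed
      have "card (\<Union>g\<in>stealable k s. (#) (mover s, g) ` ?S g) =
        (\<Sum>g\<in>stealable k s. card ((#) (mover s, g) ` ?S g))"
        using fin S by (intro card_UN_disjoint) auto
      also have "\<dots> = a * continuations r (a - 1)"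
        using S 1(4) by (simp add: card_image)
      finally have "card (\<Union>g\<in>stealable k s. (#) (mover s, g) ` ?S g) = a * continuations r (a - 1)" .
      \<comment> \<open>Stealable gifts are at most \<open>k\<close>, so the first move tells an
        unwrapping from a theft.\<close>
      moreover have "(#) (mover s, Suc k) ` ?U \<inter> (\<Union>g\<in>stealable k s. (#) (mover s, g) ` ?S g) = {}"
        by (auto simp: stealable_def)
      ultimately show ?thesis
        unfolding ordered_plays_step[OF s \<open>k < m\<close>]
        using U S fin Suc
        by (simp add: card_Un_disjoint card_image continuations_Suc[of r' a] del: continuations.simps)
    qed
  qed
  then show ?thesis using assms by blast
qed

lemma G_1_continuations: "G 1 n = continuations (Suc n) 0"
proof -
  have "G 1 n = card (ordered_plays (Suc n) 0 initial_state)"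
    by (simp add: G_def ordered_plays_def del: upt_Suc)
  then show ?thesis
    using card_ordered_plays[OF ordered_state_initial, of "Suc n"]
    by (simp add: stealable_def del: continuations.simps)
qed

section \<open>Bessel coefficients\<close>

text \<open>The recursion records
  \<open>w * (e^x * w^p)' = e^x * (w^(p + 1) + p * w^(p + 2))\<close> for
  \<open>w = 1 / (1 - x)\<close>, where index \<open>i\<close> at level \<open>n\<close> belongs to
  \<open>p = n + 1 + i\<close>.\<close>

primrec bessel_coeff :: "nat \<Rightarrow> nat \<Rightarrow> nat" where
  "bessel_coeff 0 i = (if i = 0 then 1 else 0)"
| "bessel_coeff (Suc n) i =
     bessel_coeff n i + (if i = 0 then 0 else (n + i) * bessel_coeff n (i - 1))"

lemma bessel_coeff_eq_0: "n < i \<Longrightarrow> bessel_coeff n i = 0"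
  by (induction n arbitrary: i) auto

lemma bessel_coeff_closed_form:
  "i \<le> n \<Longrightarrow> real (bessel_coeff n i) = fact (n + i) / (fact (n - i) * fact i * 2 ^ i)"
proof (induction n arbitrary: i)
  case (Suc n)
  show ?case
  proof (cases i)
    case 0
    then show ?thesis using Suc.IH[of 0] by simp
  next
    case (Suc j)
    have j: "real (bessel_coeff n j) = fact (n + j) / (fact (n - j) * fact j * 2 ^ j)"
      using Suc Suc.prems Suc.IH[of j] by simp
    show ?thesis
    proof (cases "i \<le> n")
      case True
      \<comment> \<open>With \<open>d\<close> the truncated differences inside the factorials become
        sums, which the simplifier can cancel.\<close>
      then obtain d where n: "n = Suc j + d"
        using le_Suc_ex[OF True] Suc by auto
      have "real (bessel_coeff (Suc n) i) =
          real (bessel_coeff n i) + real (n + i) * real (bessel_coeff n j)"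
        using Suc by (simp add: algebra_simps)
      also have "\<dots> = fact (Suc n + i) / (fact (Suc n - i) * fact i * 2 ^ i)"
        unfolding Suc.IH[OF True] j unfolding n Suc
        by (simp add: divide_simps) (simp add: algebra_simps)
      finally show ?thesis .
    next
      case False
      then have "n = j" using Suc Suc.prems by simp
      have "real (bessel_coeff (Suc n) i) = real (n + i) * real (bessel_coeff n j)"
        using Suc \<open>n = j\<close> by (simp add: bessel_coeff_eq_0 algebra_simps)
      also have "\<dots> = fact (Suc n + i) / (fact (Suc n - i) * fact i * 2 ^ i)"
        unfolding j unfolding \<open>n = j\<close> Suc
        by (simp add: divide_simps)
      finally show ?thesis .
    qed
  qed
qed simp

lemma bessel_y_1: "bessel_y n 1 = (\<Sum>i\<le>n. real (bessel_coeff n i))"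
  by (simp add: bessel_y_def bessel_coeff_closed_form atLeast0AtMost)

text \<open>Moves the recursion from the coefficients onto \<open>T\<close>. The general semiring
  serves both formal power series and complex functions.\<close>

lemma sum_bessel_coeff_Suc:
  fixes T :: "nat \<Rightarrow> 'a::comm_semiring_1"
  shows "(\<Sum>i\<le>Suc n. of_nat (bessel_coeff (Suc n) i) * T i) =
    (\<Sum>i\<le>n. of_nat (bessel_coeff n i) * (T i + of_nat (Suc (n + i)) * T (Suc i)))"
proof -
  have "(\<Sum>i\<le>Suc n. of_nat (bessel_coeff (Suc n) i) * T i) =
    (\<Sum>i\<le>Suc n. of_nat (bessel_coeff n i) * T i) +
    (\<Sum>i\<le>Suc n. (if i = 0 then 0 else of_nat ((n + i) * bessel_coeff n (i - 1)) * T i))"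
    unfolding sum.distrib[symmetric] by (intro sum.cong) (auto simp: distrib_right)
  also have "(\<Sum>i\<le>Suc n. (if i = 0 then 0 else of_nat ((n + i) * bessel_coeff n (i - 1)) * T i)) =
    (\<Sum>i\<le>n. of_nat (Suc (n + i) * bessel_coeff n i) * T (Suc i))"
    by (subst sum.atMost_Suc_shift) simp
  finally show ?thesis
    by (simp add: bessel_coeff_eq_0 sum.distrib[symmetric] algebra_simps)
qed

text \<open>Coefficient form of the classical
  \<open>y_(n+2)(z) = (2n + 3) * z * y_(n+1)(z) + y_n(z)\<close>.\<close>

lemma bessel_coeff_recurrence:
  "bessel_coeff (Suc (Suc n)) (Suc i) =
     (2 * n + 3) * bessel_coeff (Suc n) i + bessel_coeff n (Suc i)"
proof (cases "i \<le> Suc n")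
  case True
  \<comment> \<open>In the first two cases the last coefficient is zero; in the third the closed
    form covers all three.\<close>
  consider "i = Suc n" | "i = n" | d where "n = Suc i + d"
    using True by (metis Suc_leI le_SucE le_iff_add order_le_less)
  then have "real (bessel_coeff (Suc (Suc n)) (Suc i)) =
     real ((2 * n + 3) * bessel_coeff (Suc n) i + bessel_coeff n (Suc i))"
  proof cases
    case 1
    then show ?thesis
      by (simp add: bessel_coeff_closed_form bessel_coeff_eq_0 divide_simps del: bessel_coeff.simps)
        (simp add: algebra_simps)
  next
    case 2
    then show ?thesis
      by (simp add: bessel_coeff_closed_form bessel_coeff_eq_0 divide_simps del: bessel_coeff.simps)
        (simp add: algebra_simps)
  next
    case 3
    then show ?thesis
      by (simp add: bessel_coeff_closed_form divide_simps del: bessel_coeff.simps)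
        (simp add: algebra_simps)
  qed
  then show ?thesis by (simp only: of_nat_eq_iff)
next
  case False
  then show ?thesis by (simp add: bessel_coeff_eq_0 del: bessel_coeff.simps)
qed

section \<open>Evaluation of the counts\<close>

lemma fps_continuations:
  "Abs_fps (\<lambda>a. real (continuations (Suc n) a) / fact a) =
     fps_exp 1 * (\<Sum>i\<le>n. of_nat (bessel_coeff n i) * inverse (1 - fps_X) ^ (Suc (n + i)))"
proof -
  define f where "f r = Abs_fps (\<lambda>a. real (continuations r a) / fact a)" for r
  define w :: "real fps" where "w = inverse (1 - fps_X)"
  have w: "(1 - fps_X) * w = 1"
    unfolding w_def by (simp add: inverse_mult_eq_1')
  have dw: "fps_deriv w = w ^ 2"
    unfolding w_def by (subst fps_inverse_deriv) auto
  have dpow: "fps_deriv (w ^ Suc k) = of_nat (Suc k) * w ^ Suc (Suc k)" for k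
    by (simp only: fps_deriv_power' dw) (simp add: power2_eq_square algebra_simps)
  \<comment> \<open>This is \<open>continuations_Suc\<close> divided by \<open>fact a\<close>: the
    factor \<open>a\<close> of the theft term turns \<open>fact a\<close> into
    \<open>fact (a - 1)\<close>, hence a shift by \<open>fps_X\<close>.\<close>
  have "(1 - fps_X) * f (Suc r) = fps_deriv (f r)" for r
  proof (rule fps_ext)
    fix a
    show "fps_nth ((1 - fps_X) * f (Suc r)) a = fps_nth (fps_deriv (f r)) a"
    proof (cases a)
      case 0
      then show ?thesis by (simp add: f_def left_diff_distrib)
    next
      case (Suc b)
      have "real (continuations (Suc r) (Suc b)) / fact (Suc b) =
          real (continuations r (Suc (Suc b))) / fact (Suc b) + real (continuations (Suc r) b) / fact b"
        by (simp add: divide_simps) (simp add: algebra_simps)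
      moreover have "real (Suc a) * y / fact (Suc a) = y / fact a" for y
        by (simp add: divide_simps)
      ultimately show ?thesis
        by (simp add: f_def left_diff_distrib Suc del: fact_Suc of_nat_Suc continuations.simps)
    qed
  qed
  then have f_Suc: "f (Suc r) = w * fps_deriv (f r)" for r
    using w by (metis mult.assoc mult.commute mult_1)
  have f_0: "f 0 = fps_exp 1"
    by (simp add: f_def fps_exp_def)
  have "f (Suc n) = fps_exp 1 * (\<Sum>i\<le>n. of_nat (bessel_coeff n i) * w ^ (Suc (n + i)))"
  proof (induction n)
    case 0
    then show ?case by (simp add: f_Suc f_0)
  next
    case (Suc n)
    have "f (Suc (Suc n)) = fps_exp 1 * (\<Sum>i\<le>n. of_nat (bessel_coeff n i) *
        (w * w ^ Suc (n + i) + w * (of_nat (Suc (n + i)) * w ^ Suc (Suc (n + i)))))"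
      unfolding f_Suc[of "Suc n"] Suc
      by (simp add: fps_deriv_sum dpow sum_distrib_left sum.distrib algebra_simps
        del: of_nat_Suc power_Suc)
    also have "\<dots> = fps_exp 1 * (\<Sum>i\<le>n. of_nat (bessel_coeff n i) *
        (w ^ Suc (Suc n + i) + of_nat (Suc (n + i)) * w ^ Suc (Suc n + Suc i)))"
      by (simp add: algebra_simps)
    also have "\<dots> = fps_exp 1 * (\<Sum>i\<le>Suc n. of_nat (bessel_coeff (Suc n) i) * w ^ (Suc (Suc n + i)))"
      by (subst sum_bessel_coeff_Suc) simp
    finally show ?case .
  qed
  then show ?thesis by (simp add: f_def w_def)
qed

text \<open>At \<open>x = 0\<close> both \<open>e^x\<close> and \<open>1 / (1 - x)\<close> equal
  1.\<close>

lemma G_1_eq_sum: "G 1 n = (\<Sum>i\<le>n. bessel_coeff n i)"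
proof -
  have "real (G 1 n) = fps_nth (Abs_fps (\<lambda>a. real (continuations (Suc n) a) / fact a)) 0"
    unfolding G_1_continuations by (simp del: continuations.simps)
  also have "\<dots> = real (\<Sum>i\<le>n. bessel_coeff n i)"
    unfolding fps_continuations by (simp add: fps_sum_nth fps_power_zeroth)
  finally show ?thesis by (simp only: of_nat_eq_iff)
qed

lemma G_1_bessel: "real (G 1 n) = bessel_y n 1"
  unfolding G_1_eq_sum bessel_y_1 by simp

text \<open>The sign of \<open>pochhammer (- real n) j\<close> cancels that of
  \<open>(- 1 / 2) ^ j\<close>, and for \<open>j > n\<close> this factor vanishes, so the series is
  finite.\<close>

lemma bessel_y_hyp2F0: "bessel_y n 1 = hyp2F0 (real n + 1) (- real n) (- 1 / 2)"
proof -
  let ?t = "\<lambda>j. pochhammer (real n + 1) j * pochhammer (- real n) j * ((- 1 / 2) ^ j / fact j)"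
  have "?t j = fact (n + j) / (fact (n - j) * fact j * 2 ^ j)" if "j \<le> n" for j
  proof -
    have 1: "pochhammer (real n + 1) j = fact (n + j) / fact n"
      using pochhammer_product'[of "1::real" n j] by (simp add: pochhammer_fact[symmetric] add.commute field_simps)
    have 2: "pochhammer (- real n) j = (- 1) ^ j * (fact n / fact (n - j))"
      using that pochhammer_product[of "n - j" n "1::real"]
      by (simp add: pochhammer_minus pochhammer_fact[symmetric] of_nat_diff add.commute field_simps)
    have 3: "(- 1 / 2) ^ j = (- 1) ^ j / (2 ^ j :: real)"
      by (rule power_divide)
    show ?thesis
      unfolding 1 2 3 by (simp add: minus_one_power_iff)
  qed
  moreover have "?t j = 0" if "j \<notin> {..n}" for j
    using that pochhammer_of_nat_eq_0_iff[of n j, where 'a = real] by simp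
  ultimately show ?thesis
    unfolding hyp2F0_def by (subst suminf_finite[of "{..n}"]) (auto simp: bessel_y_def atLeast0AtMost)
qed

text \<open>Sums \<open>bessel_coeff_recurrence\<close> over \<open>i\<close>; the constant
  coefficients, which it does not reach, agree at \<open>n\<close> and \<open>n + 2\<close>.\<close>

lemma G_1_recurrence: "G 1 (Suc (Suc n)) = (2 * n + 3) * G 1 (Suc n) + G 1 n"
proof -
  have "bessel_coeff (Suc (Suc n)) 0 = bessel_coeff n 0"
    by simp
  then have "G 1 (Suc (Suc n)) = bessel_coeff n 0 + (\<Sum>i\<le>Suc n. bessel_coeff (Suc (Suc n)) (Suc i))"
    unfolding G_1_eq_sum by (subst sum.atMost_Suc_shift) simp
  also have "\<dots> = (2 * n + 3) * G 1 (Suc n) +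
      (bessel_coeff n 0 + (\<Sum>i\<le>Suc n. bessel_coeff n (Suc i)))"
    unfolding bessel_coeff_recurrence sum.distrib G_1_eq_sum sum_distrib_left[symmetric]
    by (simp only: ac_simps)
  also have "bessel_coeff n 0 + (\<Sum>i\<le>Suc n. bessel_coeff n (Suc i)) = G 1 n"
    unfolding G_1_eq_sum sum.atMost_Suc_shift[symmetric] by (simp add: bessel_coeff_eq_0)
  finally show ?thesis .
qed

section \<open>Asymptotics and generating function\<close>

text \<open>With \<open>s = csqrt (1 - 2 * x)\<close> and \<open>w = 1 / s\<close> one has
  \<open>s' = - w\<close> and \<open>w' = w^3\<close>, so
  \<open>(e^(1 - s) * w^p)' = e^(1 - s) * (w^(p + 1) + p * w^(p + 2))\<close>, the rule behind
  \<open>bessel_coeff\<close>. The assumption avoids the branch cut.\<close>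

lemma has_field_derivative_bessel_sum:
  assumes "1 - 2 * x \<notin> \<real>\<^sub>\<le>\<^sub>0"
  shows "((\<lambda>x. exp (1 - csqrt (1 - 2 * x)) *
      (\<Sum>i\<le>n. of_nat (bessel_coeff n i) * inverse (csqrt (1 - 2 * x)) ^ Suc (n + i)))
    has_field_derivative exp (1 - csqrt (1 - 2 * x)) *
      (\<Sum>i\<le>Suc n. of_nat (bessel_coeff (Suc n) i) *
        inverse (csqrt (1 - 2 * x)) ^ Suc (Suc n + i))) (at x)"
proof -
  define s where "s = csqrt (1 - 2 * x)"
  define w where "w = inverse s"
  have "s \<noteq> 0"
    using assms by (auto simp: s_def)
  have ds: "((\<lambda>x. csqrt (1 - 2 * x)) has_field_derivative - w) (at x)"
    using assms \<open>s \<noteq> 0\<close>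
    by (auto intro!: derivative_eq_intros simp: w_def s_def field_simps)
  have de: "((\<lambda>x. exp (1 - csqrt (1 - 2 * x))) has_field_derivative exp (1 - s) * w) (at x)"
    by (rule derivative_eq_intros ds refl)+ (simp add: s_def)
  have dw: "((\<lambda>x. inverse (csqrt (1 - 2 * x))) has_field_derivative w ^ 3) (at x)"
    using DERIV_inverse'[OF ds] \<open>s \<noteq> 0\<close>
    by (simp add: w_def s_def power3_eq_cube)
  have dT: "((\<lambda>x. of_nat (bessel_coeff n i) * inverse (csqrt (1 - 2 * x)) ^ Suc (n + i))
      has_field_derivative of_nat (bessel_coeff n i) *
        (of_nat (Suc (n + i)) * w ^ Suc (Suc n + Suc i))) (at x)" for i
    by (rule derivative_eq_intros dw refl)+
      (simp add: w_def s_def power3_eq_cube algebra_simps)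
  have "((\<lambda>x. exp (1 - csqrt (1 - 2 * x)) *
      (\<Sum>i\<le>n. of_nat (bessel_coeff n i) * inverse (csqrt (1 - 2 * x)) ^ Suc (n + i)))
    has_field_derivative exp (1 - s) *
      (\<Sum>i\<le>n. of_nat (bessel_coeff n i) *
        (w ^ Suc (Suc n + i) + of_nat (Suc (n + i)) * w ^ Suc (Suc n + Suc i)))) (at x)"
    by (rule DERIV_cong[OF DERIV_mult[OF de DERIV_sum[OF dT]]])
      (simp only: s_def[symmetric] w_def[symmetric],
        simp add: sum_distrib_left sum.distrib algebra_simps del: of_nat_Suc)
  also have "(\<Sum>i\<le>n. of_nat (bessel_coeff n i) *
        (w ^ Suc (Suc n + i) + of_nat (Suc (n + i)) * w ^ Suc (Suc n + Suc i))) =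
      (\<Sum>i\<le>Suc n. of_nat (bessel_coeff (Suc n) i) * w ^ Suc (Suc n + i))"
    by (rule sum_bessel_coeff_Suc[symmetric])
  finally show ?thesis
    unfolding w_def s_def .
qed

lemma G_1_egf:
  fixes x :: complex
  assumes "norm x < 1 / 2"
  shows "(\<lambda>n. of_nat (G 1 n) * (x ^ n / fact n)) sums
    (exp (1 - csqrt (1 - 2 * x)) / csqrt (1 - 2 * x))"
proof -
  define g where "g n x = exp (1 - csqrt (1 - 2 * x)) *
      (\<Sum>i\<le>n. of_nat (bessel_coeff n i) * inverse (csqrt (1 - 2 * x)) ^ Suc (n + i))"
    for n and x :: complex
  have dg: "(g n has_field_derivative g (Suc n) y) (at y)" if "y \<in> ball 0 (1 / 2)" for n y
  proof -
    \<comment> \<open>Hence \<open>1 - 2 * y\<close> has positive real part and stays off the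
      cut.\<close>
    have "Re y < 1 / 2"
      using that complex_Re_le_cmod[of y] by simp
    then have "1 - 2 * y \<notin> \<real>\<^sub>\<le>\<^sub>0"
      by (auto simp: complex_nonpos_Reals_iff)
    then show ?thesis
      unfolding g_def by (rule has_field_derivative_bessel_sum)
  qed
  have derivs: "(deriv ^^ n) (g 0) y = g n y" if "y \<in> ball 0 (1 / 2)" for n y
    using that
  proof (induction n arbitrary: y)
    case (Suc n)
    have "((deriv ^^ n) (g 0) has_field_derivative g (Suc n) y) (at y)"
      by (rule has_field_derivative_transform_within_open[OF dg[OF Suc.prems] open_ball Suc.prems])
        (rule Suc.IH[symmetric])
    then show ?case
      by (simp add: DERIV_imp_deriv)
  qed simp
  have "g 0 holomorphic_on ball 0 (1 / 2)"
    using dg by (meson holomorphic_on_open open_ball)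
  then have "(\<lambda>n. (deriv ^^ n) (g 0) 0 / fact n * (x - 0) ^ n) sums g 0 x"
    by (rule holomorphic_power_series) (use assms in simp)
  \<comment> \<open>At 0 the root and the exponential are both 1, which leaves the sum of the
    coefficients.\<close>
  moreover have "(deriv ^^ n) (g 0) 0 = of_nat (G 1 n)" for n
    by (subst derivs) (simp_all add: g_def G_1_eq_sum[unfolded One_nat_def])
  ultimately show ?thesis
    by (simp add: g_def field_simps)
qed

section \<open>Asymptotics via ratios to the top coefficient\<close>

lemma prod_falling_ratio:
  assumes "k \<le> n"
  shows "(\<Prod>j<k. (2 * real n - 2 * real j) / (2 * real n - real j)) =
    fact (2 * n - k) * fact n * 2 ^ k / (fact (2 * n) * fact (n - k))"
  using assms
proof (induction k)
  case (Suc k)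
  then obtain d where n: "n = Suc k + d"
    using le_Suc_ex by blast
  have 1: "2 * n - k = Suc (Suc (k + 2 * d))" "2 * n - Suc k = Suc (k + 2 * d)"
    "n - k = Suc d" "n - Suc k = d"
    using n by auto
  have 2: "2 * real n - 2 * real k = 2 * real (Suc d)" "2 * real n - real k = real (Suc (Suc (k + 2 * d)))"
    using n by auto
  have "k \<le> n"
    using Suc.prems by simp
  from Suc.IH[OF this] show ?case
    by (simp only: prod.lessThan_Suc 1 2) (simp add: divide_simps del: of_nat_Suc)
qed simp

text \<open>The factor of the product with \<open>j = n\<close> vanishes, so this also covers \<open>k > n\<close>.\<close>
lemma abs_prod_falling_ratio_le_1:
  "\<bar>\<Prod>j<k. (2 * real n - 2 * real j) / (2 * real n - real j)\<bar> \<le> 1"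
proof (cases "k \<le> n")
  case True
  then show ?thesis
    unfolding abs_prod by (intro prod_le_1) (auto simp: divide_simps)
next
  case False
  then have "(\<Prod>j<k. (2 * real n - 2 * real j) / (2 * real n - real j)) = 0"
    by (intro prod_zero) (auto intro: bexI[of _ n])
  then show ?thesis by (simp only: abs_zero zero_le_one)
qed

text \<open>The divisor is \<open>bessel_coeff n n\<close>, and the product is a quotient of falling
  factorials, \<open>2^k * n! / (n - k)!\<close> over \<open>(2n)! / (2n - k)!\<close>. An infinite
  series whose terms vanish for \<open>k > n\<close> frees the summation range from
  \<open>n\<close>, ready for a limit under the sum.\<close>

lemma G_1_ratio:
  "real (G 1 n) / (fact (2 * n) / (fact n * 2 ^ n)) =
    (\<Sum>k. (\<Prod>j<k. (2 * real n - 2 * real j) / (2 * real n - real j)) / fact k)"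
proof -
  let ?D = "fact (2 * n) / (fact n * 2 ^ n) :: real"
  let ?a = "\<lambda>k. (\<Prod>j<k. (2 * real n - 2 * real j) / (2 * real n - real j)) / fact k"
  have "real (bessel_coeff n (n - k)) / ?D = ?a k" if k: "k \<le> n" for k
  proof -
    obtain d where n: "n = k + d"
      using le_Suc_ex[OF k] by blast
    have "n + (n - k) = 2 * n - k" "n - (n - k) = k"
      using k by auto
    then have "real (bessel_coeff n (n - k)) = fact (2 * n - k) / (fact k * fact (n - k) * 2 ^ (n - k))"
      by (simp add: bessel_coeff_closed_form)
    then show ?thesis
      unfolding prod_falling_ratio[OF k] by (simp add: n power_add divide_simps ac_simps)
  qed
  moreover have "real (G 1 n) = (\<Sum>k\<le>n. real (bessel_coeff n (n - k)))"
    unfolding G_1_eq_sum of_nat_sum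
    by (rule sum.reindex_bij_witness[of _ "\<lambda>k. n - k" "\<lambda>k. n - k"]) auto
  ultimately have "real (G 1 n) / ?D = (\<Sum>k\<le>n. ?a k)"
    by (simp only: sum_divide_distrib) simp
  moreover have "?a k = 0" if "k \<notin> {..n}" for k
    using that by (auto intro!: prod_zero bexI[of _ n])
  ultimately show ?thesis
    by (subst suminf_finite[of "{..n}"]) simp_all
qed

lemma G_1_asymp_equiv:
  "(\<lambda>n. real (G 1 n)) \<sim>[at_top] (\<lambda>n. exp 1 * fact (2 * n) / (fact n * 2 ^ n))"
proof -
  define a where "a k n = (\<Prod>j<k. (2 * real n - 2 * real j) / (2 * real n - real j)) / fact k"
    for k n :: nat
  have "(\<lambda>n. (2 * real n - 2 * real j) / (2 * real n - real j)) \<longlonglongrightarrow> 1" for j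
    by real_asymp
  then have "(\<lambda>n. a k n) \<longlonglongrightarrow> (\<Prod>j<k. 1) / fact k" for k
    unfolding a_def by (intro tendsto_intros) auto
  then have lim: "(\<lambda>n. a k n) \<longlonglongrightarrow> 1 / fact k" for k
    by simp
  have "norm (a k n) \<le> 1 / fact k" for k n
    using abs_prod_falling_ratio_le_1[of n k] by (simp add: a_def divide_simps)
  then have bound: "\<forall>\<^sub>F (k, n) in sequentially \<times>\<^sub>F sequentially. norm (a k n) \<le> 1 / fact k"
    by (intro always_eventually) auto
  have exp1: "(\<lambda>k. 1 / fact k) sums exp (1::real)"
    using exp_converges[of "1::real"] by (simp add: field_simps)
  \<comment> \<open>Dominated convergence for series; the majorant is the exponential series at
    1.\<close>
  have "(\<lambda>n. \<Sum>k. a k n) \<longlonglongrightarrow> (\<Sum>k. 1 / fact k)"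
    using tannerys_theorem[OF lim bound] exp1 by (simp add: sums_iff)
  then have "(\<lambda>n. real (G 1 n) / (fact (2 * n) / (fact n * 2 ^ n))) \<longlonglongrightarrow> exp 1"
    unfolding G_1_ratio using exp1 by (simp add: a_def sums_iff)
  then have "(\<lambda>n. real (G 1 n) / (fact (2 * n) / (fact n * 2 ^ n)) / exp 1) \<longlonglongrightarrow> exp 1 / exp 1"
    by (intro tendsto_divide tendsto_const) auto
  then show ?thesis
    by (intro asymp_equivI') (simp add: field_simps)
qed

theorem theorem3:
  shows "(\<forall>n. real (G 1 n) = bessel_y n 1)
    \<and> (\<forall>n. real (G 1 n) = hyp2F0 (real n + 1) (- real n) (- 1 / 2))
    \<and> (\<forall>n\<ge>2. G 1 n = (2 * n - 1) * G 1 (n - 1) + G 1 (n - 2)) \<and> G 1 0 = 1 \<and> G 1 1 = 2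
    \<and> (\<forall>x::complex. norm x < 1 / 2 \<longrightarrow>
         (\<lambda>n. of_nat (G 1 n) * (x ^ n / fact n)) sums
           (exp (1 - csqrt (1 - 2 * x)) / csqrt (1 - 2 * x)))
    \<and> (\<lambda>n. real (G 1 n)) \<sim>[at_top] (\<lambda>n. exp 1 * fact (2 * n) / (fact n * 2 ^ n))"
proof (intro conjI allI impI)
  fix n :: nat assume "2 \<le> n"
  then obtain k where "n = Suc (Suc k)"
    using le_Suc_ex[of 2 n] by auto
  then show "G 1 n = (2 * n - 1) * G 1 (n - 1) + G 1 (n - 2)"
    using G_1_recurrence[of k] by (simp add: algebra_simps)
next
  fix n
  show "real (G 1 n) = hyp2F0 (real n + 1) (- real n) (- 1 / 2)"
    unfolding G_1_bessel by (rule bessel_y_hyp2F0)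
next
  show "G 1 0 = 1" "G 1 1 = 2"
    unfolding G_1_eq_sum by simp_all
qed (assumption | rule G_1_bessel G_1_egf G_1_asymp_equiv)+

end
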